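(* Let $\mathcal F:\mathbb{R}^p\to\mathbb{R}^n$, $y\in\mathbb{R}^n$, $L(w)=\frac12\|\mathcal F(w)-y\|^2$, and let $w_0\in\mathbb{R}^p$. Assume $\mathcal F$ is $\mathcal L_{\mathcal F}$-Lipschitz, $L$ is $\beta_L$-smooth, and $L$ is $\mu$-PL$^\star$ in $B(w_0,2R)$ with $R=\frac{2\sqrt{2\beta_LL(w_0)}}{\mu}$. Let $\varepsilon\in(0,1)$, let $M,\varepsilon_{\mathrm{loc}}$ be as in the context, and set $\rho=\min\big\{\frac{\varepsilon_{\mathrm{loc}}}{19\sqrt{\beta_L/\mu}},\sqrt\mu R,R\big\}$. Run gradient descent $w_{k+1}=w_k-\frac1{\beta_L}\nabla L(w_k)$ from $w_0$ for $k=\frac{\beta_L}{\mu}\log\Big(\frac{4\max\{2\beta_L,1\}L(w_0)}{\mu\rho^2}\Big)$ iterations. Then gradient descent outputs a point $w_{\mathrm{loc}}$ satisfying $$L(w_{\mathrm{loc}})\le\frac{\mu\rho^2}{4}\min\Big\{1,\frac1{2\beta_L}\Big\},\qquad \|w_{\mathrm{loc}}-w_\star\|_{H_L(w_\star)+\mu I}\le\rho\ \text{ for some } w_\star\in\mathcal W_\star.$$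
   Context: $\mathcal W_\star$ is the set of minimizers of $L$ (global minimizers with $L=0$). $H_L$ is the Hessian of $L$; $\|v\|_A=\sqrt{v^TAv}$. $L$ is $\mu$-PL$^\star$ on a set $S$ if $\frac12\|\nabla L(w)\|^2\ge\mu L(w)$ for all $w\in S$. $\mathcal L_{H_L}$ is the Lipschitz constant of $H_L$ on $B(w_0,2R)$; $\mathcal L_{J_{\mathcal F}}=\sup_{w\in B(w_0,2R)}\max_{i\in[n]}\|H_{\mathcal F_i}(w)\|$ where $H_{\mathcal F_i}$ is the Hessian of the $i$-th component of $\mathcal F$; $M=\max\{\mathcal L_{H_L},\mathcal L_{J_{\mathcal F}},\mathcal L_{\mathcal F}\mathcal L_{J_{\mathcal F}},1\}$ and $\varepsilon_{\mathrm{loc}}=\frac{\varepsilon\mu^{3/2}}{4M}$. *)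

theory Defs
  imports "HOL-Analysis.Analysis"
begin

primrec gd :: "('a::real_vector \<Rightarrow> 'a) \<Rightarrow> real \<Rightarrow> 'a \<Rightarrow> nat \<Rightarrow> 'a" where
  "gd g \<beta> w0 0 = w0"
| "gd g \<beta> w0 (Suc k) = gd g \<beta> w0 k - (1 / \<beta>) *\<^sub>R g (gd g \<beta> w0 k)"

definition opnorm :: "real^'p^'m \<Rightarrow> real" where
  "opnorm A = onorm (\<lambda>x. A *v x)"

definition Anorm :: "real^'p^'p \<Rightarrow> real^'p \<Rightarrow> real" where
  "Anorm A v = sqrt (v \<bullet> (A *v v))"

definition lip_quots :: "(real^'p) set \<Rightarrow> (real^'p \<Rightarrow> real^'q^'r) \<Rightarrow> real set" where
  "lip_quots S H = {opnorm (H u - H v) / norm (u - v) | u v. u \<in> S \<and> v \<in> S \<and> u \<noteq> v}"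

definition lip_const :: "(real^'p) set \<Rightarrow> (real^'p \<Rightarrow> real^'q^'r) \<Rightarrow> real" where
  "lip_const S H = Sup (lip_quots S H)"

definition hess_vals :: "(real^'p) set \<Rightarrow> (real^'p \<Rightarrow> 'n::finite \<Rightarrow> real^'p^'p) \<Rightarrow> real set" where
  "hess_vals S HF = {Max (range (\<lambda>i. opnorm (HF w i))) | w. w \<in> S}"

definition hess_bound :: "(real^'p) set \<Rightarrow> (real^'p \<Rightarrow> 'n::finite \<Rightarrow> real^'p^'p) \<Rightarrow> real" where
  "hess_bound S HF = Sup (hess_vals S HF)"

end

(* The descent lemma and the PL inequality make each gradient step shrink the loss by the
   factor q^2 = 1 - mu/beta and move the iterate by at most K (sqrt a - sqrt b), where a, b
   are the losses before and after the step and K = (1 + q) sqrt (2/mu).  The path length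
   therefore telescopes: the iterates stay in B(w0, R), where PL holds, form a Cauchy
   sequence, and converge to a zero w_star of L with |w_k - w_star| <= K sqrt (L w_k).
   At w_star the gradient vanishes, so a second-order expansion with Lipschitz Hessian gives
   v' H_L(w_star) v <= 2 L(w_star + v) + M |v|^3.  After the prescribed number of steps L(w_k)
   is small enough to make v' H_L(w_star) v + mu |v|^2 <= rho^2 for v = w_k - w_star. *)

theory Submission
  imports Defs
begin

lemma has_real_derivative_along_line:
  fixes L :: "'a::real_inner \<Rightarrow> real"
  assumes "\<And>w. (L has_derivative (\<lambda>h. G w \<bullet> h)) (at w)"
  shows "((\<lambda>t. L (x + t *\<^sub>R d)) has_real_derivative G (x + t *\<^sub>R d) \<bullet> d) (at t)"
proof -
  have "((\<lambda>t. x + t *\<^sub>R d) has_derivative (\<lambda>h. h *\<^sub>R d)) (at t)"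
    by (auto intro!: derivative_eq_intros)
  from has_derivative_compose[OF this assms]
  show ?thesis unfolding has_field_derivative_def
    by (rule has_derivative_eq_rhs) (auto simp: fun_eq_iff)
qed

lemma has_real_derivative_inner_along_line:
  fixes G :: "real^'n \<Rightarrow> real^'n"
  assumes "\<And>w. (G has_derivative (\<lambda>h. H w *v h)) (at w)"
  shows "((\<lambda>t. G (x + t *\<^sub>R d) \<bullet> d) has_real_derivative (H (x + t *\<^sub>R d) *v d) \<bullet> d) (at t)"
proof -
  have "((\<lambda>t. x + t *\<^sub>R d) has_derivative (\<lambda>h. h *\<^sub>R d)) (at t)"
    by (auto intro!: derivative_eq_intros)
  from has_derivative_inner_left[OF has_derivative_compose[OF this assms], of d]
  show ?thesis unfolding has_field_derivative_def
    by (rule has_derivative_eq_rhs)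
      (simp add: fun_eq_iff matrix_scaleR_vector_ac scaleR_matrix_vector_assoc[symmetric])
qed

lemma descent_lemma:
  fixes L :: "'a::real_inner \<Rightarrow> real"
  assumes gradient: "\<And>w. (L has_derivative (\<lambda>h. G w \<bullet> h)) (at w)"
    and smooth: "\<beta>-lipschitz_on UNIV G"
  shows "L (x + d) \<le> L x + G x \<bullet> d + \<beta> / 2 * (norm d)\<^sup>2"
proof -
  define \<psi> where "\<psi> t = L x + t * (G x \<bullet> d) + \<beta> / 2 * t\<^sup>2 * (norm d)\<^sup>2 - L (x + t *\<^sub>R d)" for t
  have "\<psi> 0 \<le> \<psi> 1"
  proof (rule deriv_nonneg_imp_mono[where g = \<psi>])
    fix t :: real
    assume t: "t \<in> {0..1}"
    show "(\<psi> has_real_derivative G x \<bullet> d + \<beta> * t * (norm d)\<^sup>2 - G (x + t *\<^sub>R d) \<bullet> d) (at t)"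
      unfolding \<psi>_def[abs_def] by (auto intro!: derivative_eq_intros has_real_derivative_along_line[OF gradient])
    have "norm (G (x + t *\<^sub>R d) - G x) \<le> \<beta> * t * norm d"
      using t lipschitz_onD[OF smooth, of "x + t *\<^sub>R d" x] by (simp add: dist_norm mult.assoc)
    then have "norm (G (x + t *\<^sub>R d) - G x) * norm d \<le> \<beta> * t * (norm d)\<^sup>2"
      by (metis mult_right_mono norm_ge_zero power2_eq_square mult.assoc)
    with norm_cauchy_schwarz[of "G (x + t *\<^sub>R d) - G x" d]
    show "0 \<le> G x \<bullet> d + \<beta> * t * (norm d)\<^sup>2 - G (x + t *\<^sub>R d) \<bullet> d"
      by (simp add: inner_diff_left)
  qed simp
  then show ?thesis by (simp add: \<psi>_def)
qed

lemma gradient_step_decrease: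
  fixes L :: "'a::real_inner \<Rightarrow> real"
  assumes "\<And>w. (L has_derivative (\<lambda>h. G w \<bullet> h)) (at w)" "\<beta>-lipschitz_on UNIV G" "0 < \<beta>"
  shows "L (x - (1 / \<beta>) *\<^sub>R G x) \<le> L x - (norm (G x))\<^sup>2 / (2 * \<beta>)"
  using descent_lemma[OF assms(1,2), of x "- (1 / \<beta>) *\<^sub>R G x"] assms(3)
  by (simp add: dot_square_norm power2_eq_square field_simps)

lemma norm_gradient_sq_le:
  fixes L :: "'a::real_inner \<Rightarrow> real"
  assumes "\<And>w. (L has_derivative (\<lambda>h. G w \<bullet> h)) (at w)" "\<beta>-lipschitz_on UNIV G" "0 < \<beta>"
    and "\<And>w. 0 \<le> L w"
  shows "(norm (G x))\<^sup>2 \<le> 2 * \<beta> * L x"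
proof -
  have "0 \<le> \<beta> * L (x - (1 / \<beta>) *\<^sub>R G x)"
    using assms(3,4) by simp
  with gradient_step_decrease[OF assms(1-3), of x] assms(3) show ?thesis
    by (simp add: field_simps)
qed

lemma PL_constant_le_smoothness:
  fixes L :: "'a::real_inner \<Rightarrow> real"
  assumes "\<And>w. (L has_derivative (\<lambda>h. G w \<bullet> h)) (at w)" "\<beta>-lipschitz_on UNIV G" "0 < \<beta>"
    and "\<And>w. 0 \<le> L w" "0 < L x" "\<mu> * L x \<le> (norm (G x))\<^sup>2 / 2"
  shows "\<mu> \<le> \<beta>"
proof -
  have "\<mu> * L x \<le> \<beta> * L x"
    using norm_gradient_sq_le[OF assms(1-4), of x] assms(6) by simp
  with assms(5) show ?thesis
    by simp
qed

lemma gd_fixed_point: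
  assumes "g w0 = 0"
  shows "gd g \<beta> w0 k = w0"
  using assms by (induction k) simp_all

lemma hessian_form_le_loss_at_zero:
  fixes L :: "real^'n \<Rightarrow> real"
  assumes gradient: "\<And>w. (L has_derivative (\<lambda>h. G w \<bullet> h)) (at w)"
    and hessian: "\<And>w. (G has_derivative (\<lambda>h. H w *v h)) (at w)"
    and "L x = 0" "G x = 0"
    and hessian_lower: "\<And>t. t \<in> {0..1} \<Longrightarrow> v \<bullet> (H x *v v) - c \<le> v \<bullet> (H (x + t *\<^sub>R v) *v v)"
  shows "v \<bullet> (H x *v v) \<le> 2 * L (x + v) + c"
proof -
  define a where "a = v \<bullet> (H x *v v) - c"
  have slope: "a * t \<le> G (x + t *\<^sub>R v) \<bullet> v" if "t \<in> {0..1}" for t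
  proof -
    have "G (x + 0 *\<^sub>R v) \<bullet> v - a * 0 \<le> G (x + t *\<^sub>R v) \<bullet> v - a * t"
    proof (rule deriv_nonneg_imp_mono[where g = "\<lambda>s. G (x + s *\<^sub>R v) \<bullet> v - a * s"])
      fix s :: real
      assume s: "s \<in> {0..t}"
      show "((\<lambda>s. G (x + s *\<^sub>R v) \<bullet> v - a * s) has_real_derivative (H (x + s *\<^sub>R v) *v v) \<bullet> v - a) (at s)"
        by (auto intro!: derivative_eq_intros has_real_derivative_inner_along_line[OF hessian])
      show "0 \<le> (H (x + s *\<^sub>R v) *v v) \<bullet> v - a"
        using hessian_lower[of s] s that by (simp add: a_def inner_commute)
    qed (use that in simp)
    then show ?thesis using \<open>G x = 0\<close> by simp
  qed
  have "L (x + 0 *\<^sub>R v) - a * 0\<^sup>2 / 2 \<le> L (x + 1 *\<^sub>R v) - a * 1\<^sup>2 / 2"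
  proof (rule deriv_nonneg_imp_mono[where g = "\<lambda>s. L (x + s *\<^sub>R v) - a * s\<^sup>2 / 2"])
    fix s :: real
    assume "s \<in> {0..1}"
    show "((\<lambda>s. L (x + s *\<^sub>R v) - a * s\<^sup>2 / 2) has_real_derivative G (x + s *\<^sub>R v) \<bullet> v - a * s) (at s)"
      by (auto intro!: derivative_eq_intros has_real_derivative_along_line[OF gradient])
    show "0 \<le> G (x + s *\<^sub>R v) \<bullet> v - a * s"
      using slope[OF \<open>s \<in> {0..1}\<close>] by simp
  qed simp
  then show ?thesis using \<open>L x = 0\<close> by (simp add: a_def)
qed

lemma telescoping_dist_convergent:
  fixes w :: "nat \<Rightarrow> 'a::complete_space" and s :: "nat \<Rightarrow> real"
  assumes dist_step: "\<And>j. dist (w j) (w (Suc j)) \<le> s j - s (Suc j)"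
    and nonneg: "\<And>j. 0 \<le> s j"
  obtains l where "w \<longlonglongrightarrow> l" "\<And>t. dist (w t) l \<le> s t"
proof -
  have path: "dist (w t) (w m) \<le> s t - s m" if "t \<le> m" for t m
    using that
  proof (induction m rule: dec_induct)
    case (step m)
    then show ?case
      using dist_triangle[of "w t" "w (Suc m)" "w m"] dist_step[of m] by simp
  qed simp
  have "decseq s"
    using dist_step by (intro decseq_SucI) (smt (verit) zero_le_dist)
  then obtain \<sigma> where "s \<longlonglongrightarrow> \<sigma>"
    using nonneg decseq_convergent[of s 0] by blast
  then have "Cauchy s"
    by (rule LIMSEQ_imp_Cauchy)
  have "dist (w m) (w n) \<le> dist (s m) (s n)" for m n
    using path[of m n] path[of n m] \<open>decseq s\<close>
    by (cases "m \<le> n") (auto simp: dist_real_def dist_commute decseq_def)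
  have "Cauchy w"
  proof (rule metric_CauchyI)
    fix e :: real
    assume "0 < e"
    then obtain N where "\<forall>m\<ge>N. \<forall>n\<ge>N. dist (s m) (s n) < e"
      using metric_CauchyD[OF \<open>Cauchy s\<close>] by blast
    then show "\<exists>N. \<forall>m\<ge>N. \<forall>n\<ge>N. dist (w m) (w n) < e"
      using \<open>\<And>m n. dist (w m) (w n) \<le> dist (s m) (s n)\<close> order_le_less_trans by blast
  qed
  then obtain l where l: "w \<longlonglongrightarrow> l"
    using Cauchy_convergent_iff convergent_def by blast
  have "dist (w t) l \<le> s t" for t
  proof (rule LIMSEQ_le_const2)
    show "(\<lambda>m. dist (w t) (w m)) \<longlonglongrightarrow> dist (w t) l"
      by (intro tendsto_intros l)
    show "\<exists>N. \<forall>m\<ge>N. dist (w t) (w m) \<le> s t"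
      using path nonneg by (smt (verit))
  qed
  with l that show ?thesis by blast
qed

lemma power_le_inverse_after_log_steps:
  fixes \<kappa> X :: real
  assumes "0 < \<kappa>" "\<kappa> \<le> 1" "0 < X" "ln X / \<kappa> \<le> real k"
  shows "(1 - \<kappa>) ^ k \<le> 1 / X"
proof -
  have "(1 - \<kappa>) ^ k \<le> exp (- \<kappa>) ^ k"
    using assms(2) exp_ge_add_one_self[of "- \<kappa>"] by (intro power_mono) auto
  also have "\<dots> = exp (- (\<kappa> * real k))"
    by (simp add: exp_of_nat_mult[symmetric] mult.commute)
  also have "\<dots> \<le> exp (- ln X)"
    using assms(1,4) by (simp add: pos_divide_le_eq mult.commute)
  also have "\<dots> = 1 / X"
    using assms(3) by (simp add: exp_minus inverse_eq_divide)
  finally show ?thesis .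
qed

lemma PL_descent_contraction:
  fixes a b g \<beta> \<mu> :: real
  assumes "0 < \<beta>" "b \<le> a - g\<^sup>2 / (2 * \<beta>)" "\<mu> * a \<le> g\<^sup>2 / 2"
  shows "b \<le> (1 - \<mu> / \<beta>) * a"
  using assms divide_right_mono[OF assms(3), of \<beta>] by (simp add: left_diff_distrib)

(* a - b = (sqrt a - sqrt b)(sqrt a + sqrt b) is at least g^2/(2 beta), while
   sqrt a + sqrt b <= (1 + q) sqrt a <= (1 + q) g / sqrt (2 mu). *)
lemma step_length_le_sqrt_decrease:
  fixes a b g \<beta> \<mu> :: real
  assumes "0 < \<mu>" "\<mu> \<le> \<beta>" "0 \<le> g" "0 \<le> b"
    and descent: "b \<le> a - g\<^sup>2 / (2 * \<beta>)"
    and PL: "\<mu> * a \<le> g\<^sup>2 / 2"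
  shows "g / \<beta> \<le> (1 + sqrt (1 - \<mu> / \<beta>)) * sqrt (2 / \<mu>) * (sqrt a - sqrt b)"
proof -
  define q where "q = sqrt (1 - \<mu> / \<beta>)"
  have "0 \<le> q" "q\<^sup>2 = 1 - \<mu> / \<beta>" "q \<le> 1"
    using assms(1,2) by (auto simp: q_def)
  have "0 \<le> a" "0 < \<beta>"
    using assms by (smt (verit) zero_le_power2 divide_nonneg_nonneg)+
  have "b \<le> q\<^sup>2 * a"
    using PL_descent_contraction[OF \<open>0 < \<beta>\<close> descent PL] \<open>q\<^sup>2 = 1 - \<mu> / \<beta>\<close> by simp
  then have sqrt_b: "sqrt b \<le> q * sqrt a"
    using \<open>0 \<le> q\<close> real_sqrt_le_mono by (fastforce simp: real_sqrt_mult)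
  have "sqrt b \<le> sqrt a"
    using sqrt_b mult_left_le_one_le[of "sqrt a" q] \<open>q \<le> 1\<close> \<open>0 \<le> q\<close> \<open>0 \<le> a\<close>
    by (smt (verit) real_sqrt_ge_zero)
  have "sqrt a * sqrt (2 * \<mu>) \<le> g"
    using PL \<open>0 \<le> g\<close> real_sqrt_le_mono[of "a * (2 * \<mu>)" "g\<^sup>2"]
    by (simp add: real_sqrt_mult algebra_simps)
  then have sqrt_a: "sqrt a \<le> g / sqrt (2 * \<mu>)"
    using assms(1) by (simp add: pos_le_divide_eq)
  have "g\<^sup>2 / (2 * \<beta>) \<le> (sqrt a - sqrt b) * (sqrt a + sqrt b)"
    using descent \<open>0 \<le> a\<close> \<open>0 \<le> b\<close> by (simp add: algebra_simps)
  also have "\<dots> \<le> (sqrt a - sqrt b) * ((1 + q) * sqrt a)"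
    using sqrt_b \<open>sqrt b \<le> sqrt a\<close> by (intro mult_left_mono) (auto simp: algebra_simps)
  also have "\<dots> \<le> (sqrt a - sqrt b) * ((1 + q) * (g / sqrt (2 * \<mu>)))"
    using sqrt_a \<open>sqrt b \<le> sqrt a\<close> \<open>0 \<le> q\<close> by (intro mult_left_mono) auto
  finally have "g * (g / (2 * \<beta>)) \<le> g * ((1 + q) / sqrt (2 * \<mu>) * (sqrt a - sqrt b))"
    by (simp add: power2_eq_square algebra_simps)
  then have half: "g / (2 * \<beta>) \<le> (1 + q) / sqrt (2 * \<mu>) * (sqrt a - sqrt b)" if "0 < g"
    using that by (rule mult_left_le_imp_le)
  have "2 / sqrt (2 * \<mu>) = sqrt (2 / \<mu>)"
    using assms(1) by (simp add: real_sqrt_divide real_sqrt_mult field_simps)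
  then have "2 * ((1 + q) / sqrt (2 * \<mu>) * (sqrt a - sqrt b)) = (1 + q) * sqrt (2 / \<mu>) * (sqrt a - sqrt b)"
    by (metis times_divide_eq_left times_divide_eq_right mult.commute mult.left_commute)
  moreover have "0 \<le> (1 + q) * sqrt (2 / \<mu>) * (sqrt a - sqrt b)"
    using \<open>sqrt b \<le> sqrt a\<close> \<open>0 \<le> q\<close> assms(1) by simp
  ultimately show ?thesis
    using half \<open>0 \<le> g\<close> unfolding q_def[symmetric]
    by (cases "g = 0") auto
qed

lemma quadratic_form_le_opnorm:
  fixes A :: "real^'n^'n"
  shows "\<bar>v \<bullet> (A *v v)\<bar> \<le> opnorm A * (norm v)\<^sup>2"
proof -
  have "\<bar>v \<bullet> (A *v v)\<bar> \<le> norm v * norm (A *v v)"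
    by (rule Cauchy_Schwarz_ineq2)
  also have "\<dots> \<le> norm v * (opnorm A * norm v)"
    unfolding opnorm_def using onorm[OF matrix_vector_mul_bounded_linear[of A]]
    by (intro mult_left_mono) auto
  finally show ?thesis
    by (simp add: power2_eq_square algebra_simps)
qed

lemma opnorm_diff_le_lip_const:
  assumes "bdd_above (lip_quots S H)" "u \<in> S" "v \<in> S"
  shows "opnorm (H u - H v) \<le> lip_const S H * norm (u - v)"
proof (cases "u = v")
  case True
  then show ?thesis
    by (simp add: opnorm_def onorm_zero)
next
  case False
  then have "opnorm (H u - H v) / norm (u - v) \<in> lip_quots S H"
    unfolding lip_quots_def using assms(2,3) by blast
  then have "opnorm (H u - H v) / norm (u - v) \<le> lip_const S H"
    unfolding lip_const_def using assms(1) by (rule cSup_upper)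
  with False show ?thesis
    by (simp add: pos_divide_le_eq)
qed

lemma quadratic_form_lipschitz_lower_bound:
  assumes "bdd_above (lip_quots S H)" "lip_const S H \<le> M" "p \<in> S" "x \<in> S"
  shows "v \<bullet> (H x *v v) - M * norm (p - x) * (norm v)\<^sup>2 \<le> v \<bullet> (H p *v v)"
proof -
  have "v \<bullet> (H x *v v) - v \<bullet> (H p *v v) \<le> \<bar>v \<bullet> ((H p - H x) *v v)\<bar>"
    by (simp add: matrix_vector_mult_diff_rdistrib inner_diff_right)
  also have "\<dots> \<le> opnorm (H p - H x) * (norm v)\<^sup>2"
    by (rule quadratic_form_le_opnorm)
  also have "\<dots> \<le> M * norm (p - x) * (norm v)\<^sup>2"
    using opnorm_diff_le_lip_const[OF assms(1,3,4)] assms(2)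
    by (intro mult_right_mono) (meson order_trans mult_right_mono norm_ge_zero, simp)
  finally show ?thesis
    by simp
qed

lemma quadratic_form_lower_bound_on_segment:
  assumes "bdd_above (lip_quots S H)" "lip_const S H \<le> M" "0 \<le> M"
    and "convex S" "x \<in> S" "x + v \<in> S" "t \<in> {0..1}"
  shows "v \<bullet> (H x *v v) - M * norm v ^ 3 \<le> v \<bullet> (H (x + t *\<^sub>R v) *v v)"
proof -
  have "x + t *\<^sub>R v = (1 - t) *\<^sub>R x + t *\<^sub>R (x + v)"
    by (simp add: algebra_simps)
  then have "x + t *\<^sub>R v \<in> S"
    using convexD[OF assms(4-6), of "1 - t" t] assms(7) by simp
  from quadratic_form_lipschitz_lower_bound[OF assms(1,2) this assms(5), of v]
  have "v \<bullet> (H x *v v) - M * (t * norm v) * (norm v)\<^sup>2 \<le> v \<bullet> (H (x + t *\<^sub>R v) *v v)"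
    using assms(7) by simp
  moreover have "t * norm v \<le> norm v"
    using assms(7) by (simp add: mult_left_le_one_le)
  then have "M * (t * norm v) * (norm v)\<^sup>2 \<le> M * norm v ^ 3"
    using assms(3) mult_right_mono[of "M * (t * norm v)" "M * norm v" "(norm v)\<^sup>2"]
    by (simp add: mult_left_mono power2_eq_square power3_eq_cube)
  ultimately show ?thesis
    by linarith
qed

lemma Anorm_add_scaled_identity:
  "Anorm (A + c *\<^sub>R mat 1) v = sqrt (v \<bullet> (A *v v) + c * (norm v)\<^sup>2)"
  by (simp add: Anorm_def matrix_vector_mult_add_rdistrib scaleR_matrix_vector_assoc[symmetric]
      inner_add_right dot_square_norm)

lemma lipschitz_times_radius_le:
  fixes \<beta> \<mu> \<epsilon> M \<rho> :: real
  assumes "0 < \<mu>" "\<mu> \<le> \<beta>" "0 < \<epsilon>" "\<epsilon> \<le> 1" "0 < M"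
    and "\<rho> \<le> \<epsilon> * \<mu> powr (3/2) / (4 * M) / (19 * sqrt (\<beta> / \<mu>))"
  shows "M * \<rho> \<le> \<beta> * sqrt \<beta> / 76"
proof -
  have "\<mu> powr (3/2) = \<mu> * sqrt \<mu>"
    using assms(1) powr_add[of \<mu> 1 "1/2"] by (simp add: powr_half_sqrt)
  have "1 \<le> sqrt (\<beta> / \<mu>)"
    using assms(1,2) by simp
  then have "\<rho> \<le> \<epsilon> * (\<mu> * sqrt \<mu>) / (4 * M) / 19"
    using assms(6) assms(1,3,5) \<open>\<mu> powr (3/2) = \<mu> * sqrt \<mu>\<close>
    by (smt (verit) divide_left_mono divide_nonneg_pos mult_pos_pos real_sqrt_gt_zero)
  then have "M * \<rho> \<le> \<epsilon> * (\<mu> * sqrt \<mu>) / 76"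
    using assms(5) by (simp add: field_simps)
  also have "\<dots> \<le> \<mu> * sqrt \<mu> / 76"
    using assms(1,4) by (simp add: mult_left_le_one_le)
  also have "\<dots> \<le> \<beta> * sqrt \<beta> / 76"
    using assms(1,2) by (simp add: mult_mono)
  finally show ?thesis .
qed

lemma cubic_remainder_le:
  fixes \<beta> M \<rho> n :: real
  assumes "0 < \<beta>" "0 \<le> M" "0 \<le> \<rho>" "0 \<le> n" "n\<^sup>2 \<le> \<rho>\<^sup>2 / \<beta>"
    and M: "M * \<rho> \<le> \<beta> * sqrt \<beta> / 76"
  shows "M * n ^ 3 \<le> \<rho>\<^sup>2 / 76"
proof -
  have "n \<le> \<rho> / sqrt \<beta>"
    using real_sqrt_le_mono[OF assms(5)] assms(3,4) by (simp add: real_sqrt_divide)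
  then have "M * n \<le> M * \<rho> / sqrt \<beta>"
    using mult_left_mono assms(2) by fastforce
  also have "\<dots> \<le> \<beta> / 76"
    using divide_right_mono[OF M, of "sqrt \<beta>"] assms(1) by simp
  finally have "M * n * n\<^sup>2 \<le> \<beta> / 76 * (\<rho>\<^sup>2 / \<beta>)"
    using assms by (intro mult_mono) auto
  then show ?thesis
    using assms(1) by (simp add: power3_eq_cube power2_eq_square mult.assoc)
qed

lemma distance_sq_bounds:
  fixes \<beta> \<mu> \<rho> \<delta> n :: real
  defines "q \<equiv> sqrt (1 - \<mu> / \<beta>)"
  assumes "0 < \<mu>" "\<mu> \<le> \<beta>" "0 \<le> \<delta>" "0 \<le> n"
    and n: "n \<le> (1 + q) * sqrt (2 / \<mu>) * sqrt \<delta>"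
    and \<delta>: "\<delta> \<le> \<mu> * \<rho>\<^sup>2 / (8 * \<beta>)"
  shows "\<mu> * n\<^sup>2 \<le> 2 * (1 + q)\<^sup>2 * \<delta>" and "n\<^sup>2 \<le> \<rho>\<^sup>2 / \<beta>"
proof -
  have n_sq: "n\<^sup>2 \<le> (1 + q)\<^sup>2 * (2 / \<mu> * \<delta>)"
    using power_mono[OF n \<open>0 \<le> n\<close>, of 2] assms(2,4) by (simp add: power_mult_distrib)
  then show "\<mu> * n\<^sup>2 \<le> 2 * (1 + q)\<^sup>2 * \<delta>"
    using mult_left_mono[OF n_sq, of \<mu>] assms(2) by (simp add: field_simps)
  have "(1 + q)\<^sup>2 \<le> 2\<^sup>2"
    using assms(2,3) by (intro power_mono) (auto simp: q_def)
  then have "(1 + q)\<^sup>2 * (2 / \<mu> * \<delta>) \<le> 4 * (2 / \<mu> * \<delta>)"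
    using assms(2,4) by (intro mult_right_mono) auto
  with n_sq have "n\<^sup>2 \<le> 4 * (2 / \<mu> * \<delta>)"
    by linarith
  also have "\<dots> \<le> 4 * (2 / \<mu> * (\<mu> * \<rho>\<^sup>2 / (8 * \<beta>)))"
    using \<delta> assms(2) by (intro mult_left_mono) auto
  also have "\<dots> = \<rho>\<^sup>2 / \<beta>"
    using assms(2) by simp
  finally show "n\<^sup>2 \<le> \<rho>\<^sup>2 / \<beta>" .
qed

lemma one_add_sq_mult_one_sub_sq_le:
  fixes q :: real
  assumes "0 \<le> q"
  shows "(1 + (1 + q)\<^sup>2) * (1 - q\<^sup>2) \<le> 3"
proof -
  have "(1 + (1 + q)\<^sup>2) * (1 - q\<^sup>2) = 3 - ((1 - q)\<^sup>2 + 2 * q ^ 3 + q ^ 4)"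
    by (simp add: algebra_simps power2_eq_square power3_eq_cube power4_eq_xxxx)
  moreover have "0 \<le> (1 - q)\<^sup>2 + 2 * q ^ 3 + q ^ 4"
    using assms by simp
  ultimately show ?thesis
    by linarith
qed

lemma local_error_arith:
  fixes \<beta> \<mu> M \<rho> \<delta> n h :: real
  assumes "0 < \<mu>" "\<mu> \<le> \<beta>" "0 \<le> M" "0 \<le> \<rho>" "0 \<le> \<delta>" "0 \<le> n"
    and h: "h \<le> 2 * \<delta> + M * n ^ 3"
    and n: "n \<le> (1 + sqrt (1 - \<mu> / \<beta>)) * sqrt (2 / \<mu>) * sqrt \<delta>"
    and \<delta>: "\<delta> \<le> \<mu> * \<rho>\<^sup>2 / (8 * \<beta>)"
    and M: "M * \<rho> \<le> \<beta> * sqrt \<beta> / 76"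
  shows "h + \<mu> * n\<^sup>2 \<le> \<rho>\<^sup>2"
proof -
  define q where "q = sqrt (1 - \<mu> / \<beta>)"
  have "0 < \<beta>" "0 \<le> q" "\<mu> / \<beta> = 1 - q\<^sup>2"
    using assms(1,2) by (auto simp: q_def)
  note dist = distance_sq_bounds[OF assms(1,2,5,6) n \<delta>, folded q_def]
  have "M * n ^ 3 \<le> \<rho>\<^sup>2 / 76"
    using cubic_remainder_le[OF \<open>0 < \<beta>\<close> assms(3,4,6) dist(2) M] .
  then have "h + \<mu> * n\<^sup>2 \<le> 2 * (1 + (1 + q)\<^sup>2) * \<delta> + \<rho>\<^sup>2 / 76"
    using h dist(1) by (simp add: ring_distribs)
  also have "\<dots> \<le> 2 * (1 + (1 + q)\<^sup>2) * (\<mu> / \<beta> * \<rho>\<^sup>2 / 8) + \<rho>\<^sup>2 / 76"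
    using \<delta> by (intro add_right_mono mult_left_mono) auto
  also have "\<dots> = (1 + (1 + q)\<^sup>2) * (1 - q\<^sup>2) * \<rho>\<^sup>2 / 4 + \<rho>\<^sup>2 / 76"
    unfolding \<open>\<mu> / \<beta> = 1 - q\<^sup>2\<close> by (simp add: field_simps)
  \<comment> \<open>The crude bound \<open>(1 + q)\<^sup>2 \<le> 4\<close> would only give \<open>5 * \<rho>\<^sup>2 / 4\<close> here.\<close>
  also have "\<dots> \<le> 3 * \<rho>\<^sup>2 / 4 + \<rho>\<^sup>2 / 76"
    using one_add_sq_mult_one_sub_sq_le[OF \<open>0 \<le> q\<close>]
    by (intro add_right_mono divide_right_mono mult_right_mono) auto
  also have "\<dots> \<le> \<rho>\<^sup>2"
    by simp
  finally show ?thesis .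
qed

locale PL_gradient_descent =
  fixes L :: "'a::{real_inner,complete_space} \<Rightarrow> real" and G :: "'a \<Rightarrow> 'a"
    and \<beta> \<mu> r :: real and w0 :: 'a
  assumes nonneg: "\<And>w. 0 \<le> L w"
    and gradient: "\<And>w. (L has_derivative (\<lambda>h. G w \<bullet> h)) (at w)"
    and smooth: "\<beta>-lipschitz_on UNIV G"
    and \<mu>_pos: "0 < \<mu>" and \<mu>_le_\<beta>: "\<mu> \<le> \<beta>"
    and PL: "\<And>w. w \<in> cball w0 r \<Longrightarrow> \<mu> * L w \<le> (norm (G w))\<^sup>2 / 2"
    and radius: "2 * sqrt (2 * \<beta> * L w0) / \<mu> \<le> r"
begin

abbreviation iterate :: "nat \<Rightarrow> 'a" where
  "iterate \<equiv> gd G \<beta> w0"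

definition path_factor :: real where
  "path_factor = (1 + sqrt (1 - \<mu> / \<beta>)) * sqrt (2 / \<mu>)"

lemma \<beta>_pos: "0 < \<beta>"
  using \<mu>_pos \<mu>_le_\<beta> by linarith

lemma path_factor_nonneg: "0 \<le> path_factor"
  using \<mu>_pos \<mu>_le_\<beta> by (simp add: path_factor_def)

lemma path_factor_initial: "path_factor * sqrt (L w0) \<le> r"
proof -
  have "path_factor * sqrt (L w0) = (1 + sqrt (1 - \<mu> / \<beta>)) * sqrt (2 * L w0 / \<mu>)"
    by (simp add: path_factor_def real_sqrt_mult[symmetric])
  also have "\<dots> \<le> 2 * sqrt (2 * L w0 / \<mu>)"
    using \<mu>_pos \<mu>_le_\<beta> nonneg[of w0] by (intro mult_right_mono) auto
  also have "\<dots> \<le> 2 * sqrt (2 * \<beta> * L w0 / \<mu>\<^sup>2)"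
    using \<mu>_pos \<mu>_le_\<beta> nonneg[of w0]
    by (intro mult_left_mono real_sqrt_le_mono) (auto simp: field_simps power2_eq_square mult_right_mono)
  also have "\<dots> = 2 * sqrt (2 * \<beta> * L w0) / \<mu>"
    using \<mu>_pos by (simp add: real_sqrt_divide)
  finally show ?thesis
    using radius by linarith
qed

lemma gradient_step_contracts:
  assumes "x \<in> cball w0 r"
  shows "L (x - (1 / \<beta>) *\<^sub>R G x) \<le> (1 - \<mu> / \<beta>) * L x"
  using PL_descent_contraction[OF \<beta>_pos gradient_step_decrease[OF gradient smooth \<beta>_pos] PL[OF assms]] .

lemma gradient_step_length:
  assumes "x \<in> cball w0 r"
  shows "dist x (x - (1 / \<beta>) *\<^sub>R G x)
    \<le> path_factor * (sqrt (L x) - sqrt (L (x - (1 / \<beta>) *\<^sub>R G x)))"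
  using step_length_le_sqrt_decrease[OF \<mu>_pos \<mu>_le_\<beta> norm_ge_zero nonneg
      gradient_step_decrease[OF gradient smooth \<beta>_pos] PL[OF assms]] \<beta>_pos
  by (simp add: dist_norm path_factor_def)

lemma iterate_path_bound: "dist w0 (iterate j) \<le> path_factor * (sqrt (L w0) - sqrt (L (iterate j)))"
proof (induction j)
  case (Suc j)
  have "dist w0 (iterate j) \<le> r"
    using Suc path_factor_initial path_factor_nonneg real_sqrt_ge_zero[OF nonneg]
    by (smt (verit) mult_left_mono)
  then have "dist (iterate j) (iterate (Suc j))
      \<le> path_factor * (sqrt (L (iterate j)) - sqrt (L (iterate (Suc j))))"
    using gradient_step_length[of "iterate j"] by simp
  with Suc show ?case
    using dist_triangle[of w0 "iterate (Suc j)" "iterate j"] by (simp add: algebra_simps)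
qed simp

lemma iterate_in_cball: "iterate j \<in> cball w0 r"
  using iterate_path_bound[of j] path_factor_initial path_factor_nonneg
    real_sqrt_ge_zero[OF nonneg[of "iterate j"]]
  by (smt (verit) mem_cball mult_left_mono)

lemma iterate_linear_rate: "L (iterate j) \<le> (1 - \<mu> / \<beta>) ^ j * L w0"
proof (induction j)
  case (Suc j)
  have "0 \<le> 1 - \<mu> / \<beta>"
    using \<mu>_le_\<beta> \<beta>_pos by simp
  with Suc gradient_step_contracts[OF iterate_in_cball[of j]] show ?case
    by (smt (verit) gd.simps(2) mult_left_mono power_Suc mult.assoc)
qed simp

lemma iterate_after_log_steps:
  assumes "0 < X" "\<beta> / \<mu> * ln X \<le> real k"
  shows "L (iterate k) \<le> L w0 / X"
proof -
  have "(1 - \<mu> / \<beta>) ^ k \<le> 1 / X"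
    using assms \<mu>_pos \<mu>_le_\<beta> \<beta>_pos by (intro power_le_inverse_after_log_steps) (auto simp: ac_simps)
  then have "(1 - \<mu> / \<beta>) ^ k * L w0 \<le> 1 / X * L w0"
    using nonneg[of w0] by (rule mult_right_mono)
  with iterate_linear_rate[of k] show ?thesis
    by simp
qed

lemma iterate_converges_to_minimizer:
  obtains ws where "L ws = 0" "ws \<in> cball w0 r"
    "\<And>j. dist (iterate j) ws \<le> path_factor * sqrt (L (iterate j))"
proof -
  obtain ws where lim: "iterate \<longlonglongrightarrow> ws"
    and close: "\<And>j. dist (iterate j) ws \<le> path_factor * sqrt (L (iterate j))"
  proof (rule telescoping_dist_convergent)
    show "dist (iterate j) (iterate (Suc j))
        \<le> path_factor * sqrt (L (iterate j)) - path_factor * sqrt (L (iterate (Suc j)))" for j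
      using gradient_step_length[OF iterate_in_cball[of j]] by (simp add: right_diff_distrib)
    show "0 \<le> path_factor * sqrt (L (iterate j))" for j
      using path_factor_nonneg nonneg by simp
  qed blast
  have "(\<lambda>j. L (iterate j)) \<longlonglongrightarrow> L ws"
    using isCont_tendsto_compose[OF has_derivative_continuous[OF gradient] lim] .
  moreover have "(\<lambda>j. (1 - \<mu> / \<beta>) ^ j * L w0) \<longlonglongrightarrow> 0"
    using \<mu>_pos \<mu>_le_\<beta> \<beta>_pos by (intro tendsto_mult_left_zero LIMSEQ_power_zero) auto
  ultimately have "L ws \<le> 0"
    using iterate_linear_rate by (blast intro: LIMSEQ_le)
  then have "L ws = 0"
    using nonneg[of ws] by simp
  moreover have "ws \<in> cball w0 r"
    using close[of 0] path_factor_initial by simp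
  ultimately show ?thesis
    using that close by blast
qed

end

locale PL_gradient_descent_hessian = PL_gradient_descent L G \<beta> \<mu> r w0
  for L :: "real^'p \<Rightarrow> real" and G \<beta> \<mu> r w0 +
  fixes H :: "real^'p \<Rightarrow> real^'p^'p"
  assumes hessian: "\<And>w. (G has_derivative (\<lambda>h. H w *v h)) (at w)"
    and hessian_lipschitz: "bdd_above (lip_quots (cball w0 r) H)"
begin

lemma iterate_close_to_minimizer:
  assumes "0 \<le> M" "lip_const (cball w0 r) H \<le> M" "0 \<le> \<rho>" "M * \<rho> \<le> \<beta> * sqrt \<beta> / 76"
    and small: "L (iterate k) \<le> \<mu> * \<rho>\<^sup>2 / (8 * \<beta>)"
  obtains ws where "L ws = 0" "Anorm (H ws + \<mu> *\<^sub>R mat 1) (iterate k - ws) \<le> \<rho>"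
proof -
  obtain ws where ws: "L ws = 0" "ws \<in> cball w0 r"
    and close: "\<And>j. dist (iterate j) ws \<le> path_factor * sqrt (L (iterate j))"
    using iterate_converges_to_minimizer by blast
  define v where "v = iterate k - ws"
  have "G ws = 0"
    using norm_gradient_sq_le[OF gradient smooth \<beta>_pos nonneg, of ws] ws(1) by simp
  have "v \<bullet> (H ws *v v) - M * norm v ^ 3 \<le> v \<bullet> (H (ws + t *\<^sub>R v) *v v)" if "t \<in> {0..1}" for t
    using quadratic_form_lower_bound_on_segment[OF hessian_lipschitz assms(2,1) convex_cball ws(2) _ that]
      iterate_in_cball[of k] by (simp add: v_def)
  from hessian_form_le_loss_at_zero[OF gradient hessian ws(1) \<open>G ws = 0\<close> this]
  have "v \<bullet> (H ws *v v) \<le> 2 * L (iterate k) + M * norm v ^ 3"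
    by (simp add: v_def)
  moreover have "norm v \<le> path_factor * sqrt (L (iterate k))"
    using close[of k] by (simp add: v_def dist_norm)
  ultimately have "v \<bullet> (H ws *v v) + \<mu> * (norm v)\<^sup>2 \<le> \<rho>\<^sup>2"
    using local_error_arith[OF \<mu>_pos \<mu>_le_\<beta> assms(1,3) nonneg norm_ge_zero _ _ small assms(4)]
    unfolding path_factor_def by blast
  then have "Anorm (H ws + \<mu> *\<^sub>R mat 1) v \<le> \<rho>"
    using assms(3) by (simp add: Anorm_add_scaled_identity real_sqrt_le_iff real_le_lsqrt)
  with ws(1) that show ?thesis
    by (simp add: v_def)
qed

theorem local_convergence:
  assumes "0 \<le> M" "lip_const (cball w0 r) H \<le> M" "0 < \<rho>" "M * \<rho> \<le> \<beta> * sqrt \<beta> / 76"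
    and "0 < L w0" and steps: "\<beta> / \<mu> * ln (4 * max (2 * \<beta>) 1 * L w0 / (\<mu> * \<rho>\<^sup>2)) \<le> real k"
  shows "L (iterate k) \<le> \<mu> * \<rho>\<^sup>2 / 4 * min 1 (1 / (2 * \<beta>))"
    and "\<exists>ws\<in>{w. L w = 0}. Anorm (H ws + \<mu> *\<^sub>R mat 1) (iterate k - ws) \<le> \<rho>"
proof -
  have "L (iterate k) \<le> L w0 / (4 * max (2 * \<beta>) 1 * L w0 / (\<mu> * \<rho>\<^sup>2))"
    using assms(3,5) \<mu>_pos steps by (intro iterate_after_log_steps) auto
  also have "\<dots> = \<mu> * \<rho>\<^sup>2 / 4 * min 1 (1 / (2 * \<beta>))"
    using assms(3,5) \<mu>_pos \<beta>_pos by (cases "2 * \<beta> \<le> 1") (auto simp: max_def min_def field_simps)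
  finally show small: "L (iterate k) \<le> \<mu> * \<rho>\<^sup>2 / 4 * min 1 (1 / (2 * \<beta>))" .
  then have "L (iterate k) \<le> \<mu> * \<rho>\<^sup>2 / (8 * \<beta>)"
    using \<mu>_pos mult_left_mono[OF min.cobounded2, of "\<mu> * \<rho>\<^sup>2 / 4" 1 "1 / (2 * \<beta>)"] by simp
  then obtain ws where "L ws = 0" "Anorm (H ws + \<mu> *\<^sub>R mat 1) (iterate k - ws) \<le> \<rho>"
    using iterate_close_to_minimizer[OF assms(1,2) less_imp_le[OF assms(3)] assms(4)] by blast
  then show "\<exists>ws\<in>{w. L w = 0}. Anorm (H ws + \<mu> *\<^sub>R mat 1) (iterate k - ws) \<le> \<rho>"
    by blast
qed

end

theorem mainTheorem5:
  fixes F :: "real^'p \<Rightarrow> real^'n"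
    and y :: "real^'n"
    and w0 :: "real^'p"
    and J :: "real^'p \<Rightarrow> real^'p^'n"
    and HF :: "real^'p \<Rightarrow> 'n \<Rightarrow> real^'p^'p"
    and L :: "real^'p \<Rightarrow> real"
    and gradL :: "real^'p \<Rightarrow> real^'p"
    and HL :: "real^'p \<Rightarrow> real^'p^'p"
    and LF \<beta> \<mu> \<epsilon> R M \<epsilon>loc \<rho> :: real
    and k :: nat
  assumes L_def: "\<And>w. L w = (1/2) * (norm (F w - y))\<^sup>2"
    and F_deriv: "\<And>w. (F has_derivative (\<lambda>h. J w *v h)) (at w)"
    and F_hess: "\<And>w i. ((\<lambda>v. J v $ i) has_derivative (\<lambda>h. HF w i *v h)) (at w)"
    and L_grad: "\<And>w. (L has_derivative (\<lambda>h. gradL w \<bullet> h)) (at w)"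
    and L_hess: "\<And>w. (gradL has_derivative (\<lambda>h. HL w *v h)) (at w)"
    and F_lip: "LF-lipschitz_on UNIV F"
    and L_smooth: "\<beta>-lipschitz_on UNIV gradL"
    and \<beta>_pos: "\<beta> > 0"
    and \<mu>_pos: "\<mu> > 0"
    and R_def: "R = 2 * sqrt (2 * \<beta> * L w0) / \<mu>"
    and PL: "\<forall>w\<in>cball w0 (2 * R). (1/2) * (norm (gradL w))\<^sup>2 \<ge> \<mu> * L w"
    and HL_lip: "bdd_above (lip_quots (cball w0 (2 * R)) HL)"
    and HF_bdd: "bdd_above (hess_vals (cball w0 (2 * R)) HF)"
    and \<epsilon>_bounds: "0 < \<epsilon>" "\<epsilon> < 1"
    and M_def: "M = Max {lip_const (cball w0 (2 * R)) HL, hess_bound (cball w0 (2 * R)) HF,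
                        LF * hess_bound (cball w0 (2 * R)) HF, 1}"
    and \<epsilon>loc_def: "\<epsilon>loc = \<epsilon> * \<mu> powr (3/2) / (4 * M)"
    and \<rho>_def: "\<rho> = Min {\<epsilon>loc / (19 * sqrt (\<beta> / \<mu>)), sqrt \<mu> * R, R}"
    and k_def: "k = nat \<lceil>(\<beta> / \<mu>) * ln (4 * max (2 * \<beta>) 1 * L w0 / (\<mu> * \<rho>\<^sup>2))\<rceil>"
  shows "L (gd gradL \<beta> w0 k) \<le> (\<mu> * \<rho>\<^sup>2 / 4) * min 1 (1 / (2 * \<beta>))
       \<and> (\<exists>ws\<in>{w. L w = 0}. Anorm (HL ws + \<mu> *\<^sub>R mat 1) (gd gradL \<beta> w0 k - ws) \<le> \<rho>)"
proof -
  have nonneg: "\<And>w. 0 \<le> L w"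
    by (simp add: L_def)
  have "1 \<le> M" "lip_const (cball w0 (2 * R)) HL \<le> M"
    unfolding M_def by (simp_all add: Max_ge_iff)
  have "0 < \<epsilon>loc" "0 \<le> R"
    using \<epsilon>loc_def \<epsilon>_bounds R_def \<mu>_pos \<beta>_pos \<open>1 \<le> M\<close> nonneg[of w0] by simp_all
  show ?thesis
  proof (cases "L w0 = 0")
    case True
    then have "gd gradL \<beta> w0 k = w0"
      using norm_gradient_sq_le[OF L_grad L_smooth \<beta>_pos nonneg, of w0] by (simp add: gd_fixed_point)
    moreover have "0 \<le> \<rho>"
      unfolding \<rho>_def using \<open>0 < \<epsilon>loc\<close> \<open>0 \<le> R\<close> \<beta>_pos \<mu>_pos by (simp add: Min_ge_iff)
    ultimately show ?thesis
      using True \<mu>_pos \<beta>_pos by (auto simp: Anorm_def)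
  next
    case False
    then have "0 < L w0" "0 < R"
      using nonneg[of w0] R_def \<mu>_pos \<beta>_pos by auto
    have "\<mu> \<le> \<beta>"
      using PL_constant_le_smoothness[OF L_grad L_smooth \<beta>_pos nonneg \<open>0 < L w0\<close>] PL \<open>0 \<le> R\<close> by simp
    interpret PL_gradient_descent_hessian L gradL \<beta> \<mu> "2 * R" w0 HL
      using nonneg L_grad L_smooth \<mu>_pos \<open>\<mu> \<le> \<beta>\<close> PL L_hess HL_lip \<open>0 \<le> R\<close>
      by unfold_locales (auto simp flip: R_def)
    have "0 < \<rho>"
      unfolding \<rho>_def using \<open>0 < \<epsilon>loc\<close> \<open>0 < R\<close> \<beta>_pos \<mu>_pos by (simp add: Min_gr_iff)
    have "\<rho> \<le> \<epsilon> * \<mu> powr (3/2) / (4 * M) / (19 * sqrt (\<beta> / \<mu>))"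
      unfolding \<rho>_def \<epsilon>loc_def by simp
    then have "M * \<rho> \<le> \<beta> * sqrt \<beta> / 76"
      using \<open>1 \<le> M\<close> \<epsilon>_bounds by (intro lipschitz_times_radius_le[OF \<mu>_pos \<open>\<mu> \<le> \<beta>\<close>]) auto
    moreover have "\<beta> / \<mu> * ln (4 * max (2 * \<beta>) 1 * L w0 / (\<mu> * \<rho>\<^sup>2)) \<le> real k"
      unfolding k_def by (rule real_nat_ceiling_ge)
    ultimately show ?thesis
      using local_convergence[OF _ \<open>lip_const (cball w0 (2 * R)) HL \<le> M\<close> \<open>0 < \<rho>\<close> _ \<open>0 < L w0\<close>] \<open>1 \<le> M\<close>
      by simp
  qed
qed

end
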